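(* Let $n \geq 3$ be an integer. There does not exist a bidiophantine $n$-gon in which the distance between some two vertices is equal to $2$.
   Context: Polygons are simple (non-degenerate) polygons in the Euclidean plane $\mathbb{R}^2$, not necessarily convex. Natural numbers are the positive integers. A polygon is called Diophantine if the distance between every two of its vertices is a natural number. A Diophantine polygon is called bidiophantine if both coordinates of each of its vertices are integers. *)

theory Defs
  imports "HOL-Analysis.Analysis"
begin

text \<open>A polygon is given by the cyclic list of its vertices.\<close>

definition next_vertex :: "(real ^ 2) list \<Rightarrow> nat \<Rightarrow> real ^ 2" where
  "next_vertex vs i = vs ! (Suc i mod length vs)"

definition edge :: "(real ^ 2) list \<Rightarrow> nat \<Rightarrow> (real ^ 2) set" where
  "edge vs i = closed_segment (vs ! i) (next_vertex vs i)"

text \<open>Vertices are pairwise distinct, and two different edges meet at most in a common endpoint.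
  This excludes in particular polygons whose vertices are all collinear. An angle of 180 degrees
  at a single vertex is allowed.\<close>

definition simple_polygon :: "(real ^ 2) list \<Rightarrow> bool" where
  "simple_polygon vs \<longleftrightarrow>
     length vs \<ge> 3 \<and> distinct vs \<and>
     (\<forall>i<length vs. \<forall>j<length vs. i \<noteq> j \<longrightarrow>
        edge vs i \<inter> edge vs j = {vs ! i, next_vertex vs i} \<inter> {vs ! j, next_vertex vs j})"

definition diophantine_polygon :: "(real ^ 2) list \<Rightarrow> bool" where
  "diophantine_polygon vs \<longleftrightarrow>
     simple_polygon vs \<and>
     (\<forall>u\<in>set vs. \<forall>v\<in>set vs. u \<noteq> v \<longrightarrow> (\<exists>k::nat. k > 0 \<and> dist u v = real k))"

definition bidiophantine_polygon :: "(real ^ 2) list \<Rightarrow> bool" where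
  "bidiophantine_polygon vs \<longleftrightarrow>
     diophantine_polygon vs \<and> (\<forall>v\<in>set vs. \<forall>i. v $ i \<in> \<int>)"

end

theory Submission
  imports Defs
begin

text \<open>Let u, v be vertices at distance 2 and w any other vertex, with integer distances a, b to u
  and v. The inner product of w - u and v - u is (a^2 - b^2 + 4) / 2, so a and b have the same parity,
  and a - b is -2, 0 or 2 by the triangle inequality. If it is -2 or 2, the triangle is degenerate.
  If a = b, then the cross product c of w - u and v - u satisfies c^2 = 4 (a^2 - 1), which is a square
  only for c = 0. So all vertices lie on the line through u and v. But at an extreme vertex
  of a collinear polygon the two adjacent edges overlap.\<close>

text \<open>The vertex with least parameter along the line has both neighbours on the same side. The
  nearer neighbour then lies on both adjacent edges, although these may share only the extreme
  vertex.\<close>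

lemma simple_polygon_not_collinear:
  assumes "simple_polygon vs"
  shows "\<not> collinear (set vs)"
proof
  assume "collinear (set vs)"
  then obtain o' e where "\<forall>x\<in>set vs. \<exists>c. x = o' + c *\<^sub>R e"
    by (auto simp: collinear_alt)
  then obtain t where t: "\<And>x. x \<in> set vs \<Longrightarrow> x = o' + t x *\<^sub>R e"
    by metis
  define n where "n = length vs"
  have n: "n \<ge> 3" and dist: "distinct vs"
    and inter: "\<And>i j. i < n \<Longrightarrow> j < n \<Longrightarrow> i \<noteq> j \<Longrightarrow>
      edge vs i \<inter> edge vs j = {vs ! i, next_vertex vs i} \<inter> {vs ! j, next_vertex vs j}"
    using assms by (auto simp: simple_polygon_def n_def)
  have "Min (t ` set vs) \<in> t ` set vs"
    using n by (intro Min_in) (auto simp: n_def)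
  then obtain m where m: "m \<in> set vs" and "t m = Min (t ` set vs)" by auto
  then have tmin: "\<And>x. x \<in> set vs \<Longrightarrow> t m \<le> t x" by simp
  obtain i where i: "i < n" "vs ! i = m"
    using m by (auto simp: in_set_conv_nth n_def)
  \<comment> \<open>Cyclic predecessor and successor of \<open>i\<close>; they differ because
    \<open>n\<close> is at least 3.\<close>
  define j where "j = (if i = 0 then n - 1 else i - 1)"
  define k where "k = (if i = n - 1 then 0 else i + 1)"
  have jk: "j < n" "k < n" "j \<noteq> i" "k \<noteq> i" "j \<noteq> k"
    using i n by (auto simp: j_def k_def split: if_splits)
  have nxt: "next_vertex vs i = vs ! k" "next_vertex vs j = m"
    using i n by (auto simp: next_vertex_def j_def k_def n_def[symmetric])
  have sets: "vs ! j \<in> set vs" "vs ! k \<in> set vs" using jk by (auto simp: n_def)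
  have ne: "vs ! j \<noteq> m" "vs ! k \<noteq> m" "vs ! j \<noteq> vs ! k"
    using jk i dist by (auto simp: nth_eq_iff_index_eq n_def)
  have meet: "closed_segment m (vs ! k) \<inter> closed_segment (vs ! j) m = {m}"
    using inter[of i j] i jk ne nxt by (auto simp: edge_def)
  have between: "x \<in> closed_segment m y"
    if "x \<in> set vs" "y \<in> set vs" "t x \<le> t y" "y \<noteq> m" for x y
  proof -
    \<comment> \<open>The parameter determines the vertex, so the division by
      \<open>t y - t m\<close> below is legitimate.\<close>
    have "t m \<noteq> t y" using t[OF m] t[OF that(2)] that(4) by metis
    then have less: "t m < t y" using tmin[OF that(2)] by simp
    define s where "s = (t x - t m) / (t y - t m)"
    have s: "0 \<le> s" "s \<le> 1" "s * (t y - t m) = t x - t m"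
      using less that(3) tmin[OF that(1)] by (auto simp: s_def)
    have "(1 - s) *\<^sub>R m + s *\<^sub>R y = (1 - s) *\<^sub>R (o' + t m *\<^sub>R e) + s *\<^sub>R (o' + t y *\<^sub>R e)"
      using t[OF m] t[OF that(2)] by simp
    also have "\<dots> = o' + (t m + s * (t y - t m)) *\<^sub>R e"
      by (simp add: algebra_simps)
    also have "\<dots> = x" using s(3) t[OF that(1)] by simp
    finally show ?thesis using s by (auto simp: in_segment)
  qed
  show False
  proof (cases "t (vs ! j) \<le> t (vs ! k)")
    case True
    then show False using between[OF sets True ne(2)] meet ne by auto
  next
    case False
    then have "vs ! k \<in> closed_segment (vs ! j) m"
      using between[of "vs ! k" "vs ! j"] sets ne by (simp add: closed_segment_commute)
    then show False using meet ne by auto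
  qed
qed

text \<open>Here \<open>p\<close> is w - u and \<open>d\<close> is v - u. Stating this over the
  integers makes parity and factorisation available; \<open>a\<close> and \<open>b\<close> may have
  any sign.\<close>

lemma cross_eq_0_of_integer_distances:
  fixes p1 p2 d1 d2 a b :: int
  assumes d: "d1\<^sup>2 + d2\<^sup>2 = 4"
    and a: "p1\<^sup>2 + p2\<^sup>2 = a\<^sup>2" and b: "(p1 - d1)\<^sup>2 + (p2 - d2)\<^sup>2 = b\<^sup>2"
    and tri: "\<bar>a - b\<bar> \<le> 2"
  shows "p1 * d2 = p2 * d1"
proof -
  define q c where "q = p1 * d1 + p2 * d2" and "c = p1 * d2 - p2 * d1"
  have q: "2 * q = a\<^sup>2 - b\<^sup>2 + 4"
    using a b d by (simp add: q_def power2_eq_square algebra_simps)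
  \<comment> \<open>Lagrange's identity for the inner product \<open>q\<close> and the cross product
    \<open>c\<close>.\<close>
  have "c\<^sup>2 + q\<^sup>2 = (p1\<^sup>2 + p2\<^sup>2) * (d1\<^sup>2 + d2\<^sup>2)"
    by (simp add: c_def q_def power2_eq_square algebra_simps)
  then have c: "c\<^sup>2 + q\<^sup>2 = 4 * a\<^sup>2" using a d by simp
  have "even (a\<^sup>2 - b\<^sup>2)" using q by presburger
  then have "even (a - b)" by simp
  then have "b = a \<or> b = a - 2 \<or> b = a + 2" using tri by presburger
  then consider "b = a" | "b = a - 2" | "b = a + 2" by blast
  then have "c = 0"
  proof cases
    case 1
    then have c': "c\<^sup>2 = 4 * (a\<^sup>2 - 1)" using c q by simp
    then have "even (c\<^sup>2)" by simp
    then obtain h where h: "c = 2 * h" by (auto elim: evenE)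
    \<comment> \<open>Here \<open>q = 2\<close>, so \<open>a\<^sup>2 - h\<^sup>2 = 1\<close>.
      Integer factors with product 1 are equal, which forces \<open>h = 0\<close>.\<close>
    then have "(\<bar>a\<bar> - \<bar>h\<bar>) * (\<bar>a\<bar> + \<bar>h\<bar>) = 1"
      using c' by (simp add: algebra_simps power2_eq_square)
    then have "h = 0" by (auto simp: zmult_eq_1_iff)
    then show ?thesis using h by simp
  next
    case 2
    \<comment> \<open>Now \<open>q\<^sup>2 = 4 * a\<^sup>2\<close>: equality in Cauchy-Schwarz,
      leaving nothing for \<open>c\<close>. The third case differs only in sign.\<close>
    have "q = 2 * a" using q unfolding 2 by (simp add: power2_eq_square algebra_simps)
    then show ?thesis using c by simp
  next
    case 3
    have "q = - 2 * a" using q unfolding 3 by (simp add: power2_eq_square algebra_simps)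
    then show ?thesis using c by simp
  qed
  then show ?thesis by (simp add: c_def)
qed

lemma dist_real2_squared:
  fixes x y :: "real ^ 2"
  shows "(dist x y)\<^sup>2 = (x $ 1 - y $ 1)\<^sup>2 + (x $ 2 - y $ 2)\<^sup>2"
  by (simp add: dist_vec_def L2_set_def sum_2 dist_real_def)

lemma on_line_of_integer_distances:
  fixes u v w :: "real ^ 2"
  assumes int: "\<And>i. u $ i \<in> \<int>" "\<And>i. v $ i \<in> \<int>" "\<And>i. w $ i \<in> \<int>"
    and uv: "dist u v = 2" and dw: "dist w u \<in> \<int>" "dist w v \<in> \<int>"
  shows "\<exists>c. w = u + c *\<^sub>R (v - u)"
proof -
  obtain p1 p2 where p: "w $ 1 - u $ 1 = of_int p1" "w $ 2 - u $ 2 = of_int p2"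
    by (meson int Ints_cases Ints_diff)
  obtain d1 d2 where d: "v $ 1 - u $ 1 = of_int d1" "v $ 2 - u $ 2 = of_int d2"
    by (meson int Ints_cases Ints_diff)
  obtain a b where ab: "dist w u = of_int a" "dist w v = of_int b"
    using dw by (auto elim!: Ints_cases)
  have pd: "w $ 1 - v $ 1 = of_int (p1 - d1)" "w $ 2 - v $ 2 = of_int (p2 - d2)"
    using p d by simp_all
  have "real_of_int (d1\<^sup>2 + d2\<^sup>2) = of_int 4"
    using dist_real2_squared[of v u] uv d by (simp add: dist_commute)
  then have d4: "d1\<^sup>2 + d2\<^sup>2 = 4" by linarith
  have "real_of_int (p1\<^sup>2 + p2\<^sup>2) = of_int (a\<^sup>2)"
    using dist_real2_squared[of w u] ab p by simp
  then have pa: "p1\<^sup>2 + p2\<^sup>2 = a\<^sup>2" by linarith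
  have "real_of_int ((p1 - d1)\<^sup>2 + (p2 - d2)\<^sup>2) = of_int (b\<^sup>2)"
    using dist_real2_squared[of w v] ab by (simp only: pd of_int_power of_int_add)
  then have pb: "(p1 - d1)\<^sup>2 + (p2 - d2)\<^sup>2 = b\<^sup>2" by linarith
  have "\<bar>dist w u - dist w v\<bar> \<le> 2"
    using dist_triangle[of w u v] dist_triangle[of w v u] uv by (simp add: dist_commute)
  then have "\<bar>a - b\<bar> \<le> 2" using ab by linarith
  then have cr: "p1 * d2 = p2 * d1"
    using cross_eq_0_of_integer_distances[OF d4 pa pb] by simp
  \<comment> \<open>Once the cross product vanishes, w - u equals its projection onto v - u, whose
    coefficient is \<open>q\<close> divided by the squared length 4.\<close>
  define q where "q = p1 * d1 + p2 * d2"
  have "q * d1 = p1 * (d1\<^sup>2 + d2\<^sup>2)" "q * d2 = p2 * (d1\<^sup>2 + d2\<^sup>2)"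
    using cr unfolding q_def by algebra+
  then have "q * d1 = 4 * p1" "q * d2 = 4 * p2" using d4 by simp_all
  then have "real_of_int q * of_int d1 = 4 * of_int p1" "real_of_int q * of_int d2 = 4 * of_int p2"
    by (simp_all flip: of_int_mult)
  then have "w = u + (of_int q / 4) *\<^sub>R (v - u)"
    using p d by (simp add: vec_eq_iff forall_2)
  then show ?thesis by blast
qed

theorem mainTheorem2:
  fixes n :: nat
  assumes "n \<ge> 3"
  shows "\<not> (\<exists>vs. length vs = n \<and> bidiophantine_polygon vs \<and>
                (\<exists>u\<in>set vs. \<exists>v\<in>set vs. dist u v = 2))"
proof clarify
  fix vs u v
  assume bi: "bidiophantine_polygon vs" and u: "u \<in> set vs" and v: "v \<in> set vs"
    and uv: "dist u v = 2"
  have coords: "x $ i \<in> \<int>" if "x \<in> set vs" for x i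
    using bi that by (simp add: bidiophantine_polygon_def)
  \<comment> \<open>The definition speaks only of distinct vertices; including distance 0 lets
    \<open>w\<close> be \<open>u\<close> or \<open>v\<close> without a separate case.\<close>
  have dists: "dist x y \<in> \<int>" if "x \<in> set vs" "y \<in> set vs" for x y
    using bi that
    by (cases "x = y") (fastforce simp: bidiophantine_polygon_def diophantine_polygon_def)+
  have "\<forall>w\<in>set vs. \<exists>c. w = u + c *\<^sub>R (v - u)"
    using on_line_of_integer_distances[OF coords[OF u] coords[OF v] coords uv] dists u v by blast
  then have "collinear (set vs)" by (auto simp: collinear_alt)
  moreover have "simple_polygon vs"
    using bi by (simp add: bidiophantine_polygon_def diophantine_polygon_def)
  ultimately show False using simple_polygon_not_collinear by blast
qed

end
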